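(* Let $\mu>\frac12$ and let $(q_n)_{n\ge 1}$ be a sequence with $0<q_n<1$ such that $\lim_{n\to\infty} q_n=1$ and $\lim_{n\to\infty} q_n^{\,n}=a$ for some constant $a$. Then for every function $f\in Q^k_\rho(\mathbb{R}^+)$, $$\lim_{n\to\infty}\left\| D_{n,q_n}^*(f;\cdot)-f\right\|_\rho=0.$$
   Context: For $0<q<1$ and $n\in\mathbb{N}=\{1,2,\dots\}$ let $[n]_q=\frac{1-q^n}{1-q}$. For an integer $k\ge 0$ let $\theta_k=0$ if $k$ is even and $\theta_k=1$ if $k$ is odd. For $\mu>\frac12$ define $\gamma_{\mu,q}(0)=1$ and $\gamma_{\mu,q}(k+1)=\frac{1-q^{2\mu\theta_{k+1}+k+1}}{1-q}\,\gamma_{\mu,q}(k)$ for $k=0,1,2,\dots$, and $$E_{\mu,q}(x)=\sum_{k=0}^\infty \frac{q^{k(k-1)/2}x^k}{\gamma_{\mu,q}(k)},\qquad x\in[0,\infty).$$ The Dunkl $q$-parametric Sz\'asz-Mirakjan operators are, for $f\in C[0,\infty)$, $x\in[0,\infty)$, $n\in\mathbb{N}$, $$D_{n,q}^*(f;x)=\frac{1}{E_{\mu,q}([n]_qx)}\sum_{k=0}^\infty \frac{([n]_qx)^k}{\gamma_{\mu,q}(k)}\,q^{k(k-1)/2}\, f\!\left(\frac{1-q^{2\mu\theta_k+k}}{q^{k-2}(1-q^n)}\right).$$ Weighted spaces: $\mathbb{R}^+=[0,\infty)$ and $\rho(x)=1+x^2$. $P_\rho(\mathbb{R}^+)$ is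 the set of real functions $f$ on $\mathbb{R}^+$ with $|f(x)|\le M_f\,\rho(x)$ for all $x$, where $M_f$ is a constant depending only on $f$; $Q_\rho(\mathbb{R}^+)=P_\rho(\mathbb{R}^+)\cap C[0,\infty)$, with norm $\|f\|_\rho=\sup_{x\ge0}\frac{|f(x)|}{\rho(x)}$; and $Q^k_\rho(\mathbb{R}^+)$ is the set of $f\in Q_\rho(\mathbb{R}^+)$ for which $\lim_{x\to\infty}\frac{f(x)}{\rho(x)}=k$ for a (finite) constant $k$. *)

theory Defs
  imports Complex_Main "HOL-Library.Extended_Real"
begin

definition q_number :: "real \<Rightarrow> nat \<Rightarrow> real" where
  "q_number q n = (1 - q ^ n) / (1 - q)"

definition parity :: "nat \<Rightarrow> real" where
  "parity k = (if even k then 0 else 1)"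

primrec dunkl_gamma :: "real \<Rightarrow> real \<Rightarrow> nat \<Rightarrow> real" where
  "dunkl_gamma \<mu> q 0 = 1"
| "dunkl_gamma \<mu> q (Suc k) =
     (1 - q powr (2 * \<mu> * parity (k + 1) + real k + 1)) / (1 - q) * dunkl_gamma \<mu> q k"

definition dunkl_exp :: "real \<Rightarrow> real \<Rightarrow> real \<Rightarrow> real" where
  "dunkl_exp \<mu> q x = (\<Sum>k. q ^ (k * (k - 1) div 2) * x ^ k / dunkl_gamma \<mu> q k)"

text \<open>The exponent \<open>k - 2\<close> is negative for \<open>k < 2\<close>, hence the integer power.\<close>

definition dunkl_szasz ::
    "real \<Rightarrow> nat \<Rightarrow> real \<Rightarrow> (real \<Rightarrow> real) \<Rightarrow> real \<Rightarrow> real" where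
  "dunkl_szasz \<mu> n q f x =
     1 / dunkl_exp \<mu> q (q_number q n * x) *
     (\<Sum>k. (q_number q n * x) ^ k / dunkl_gamma \<mu> q k * q ^ (k * (k - 1) div 2) *
        f ((1 - q powr (2 * \<mu> * parity k + real k)) / (q powi (int k - 2) * (1 - q ^ n))))"

text \<open>Functions on \<open>[0,\<infinity>)\<close> are represented by total functions on the reals; every notion
  below depends only on the values on \<open>[0,\<infinity>)\<close>.\<close>

definition rho :: "real \<Rightarrow> real" where
  "rho x = 1 + x\<^sup>2"

definition P_rho :: "(real \<Rightarrow> real) set" where
  "P_rho = {f. \<exists>M. \<forall>x\<ge>0. \<bar>f x\<bar> \<le> M * rho x}"

definition Q_rho :: "(real \<Rightarrow> real) set" where
  "Q_rho = P_rho \<inter> {f. continuous_on {0..} f}"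

definition Q_rho_lim :: "real \<Rightarrow> (real \<Rightarrow> real) set" where
  "Q_rho_lim k = {f \<in> Q_rho. ((\<lambda>x. f x / rho x) \<longlongrightarrow> k) at_top}"

text \<open>The supremum is taken in the extended reals, so that it is \<open>\<infinity>\<close>, and not an unspecified
  real number, for functions outside \<open>P_rho\<close>.\<close>

definition rho_norm :: "(real \<Rightarrow> real) \<Rightarrow> ereal" where
  "rho_norm f = (SUP x\<in>{0..}. ereal (\<bar>f x\<bar> / rho x))"

end

theory Submission
  imports Defs "HOL-Analysis.Elementary_Metric_Spaces"
begin

text \<open>
  The functional \<open>f \<mapsto> D f x\<close> is a weighted mean over nodes, and the weights satisfy a first-order
  recursion that evaluates \<open>D t = q x\<close> and \<open>D t\<^sup>2 = q x\<^sup>2 + O(x / [n]\<^sub>q)\<close>; hence both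
  \<open>D t\<^sup>2 - x\<^sup>2\<close> and \<open>D (t - x)\<^sup>2\<close> are \<open>\<rho> x\<close> times a quantity that tends to \<open>0\<close> uniformly in \<open>x\<close>.
  A function \<open>f\<close> with \<open>f / \<rho> \<longrightarrow> k\<close> satisfies, for every \<open>\<epsilon> > 0\<close> and a suitable \<open>C\<close>,
  \<open>\<bar>f t - f x - k (t\<^sup>2 - x\<^sup>2)\<bar> \<le> \<epsilon> (\<rho> t + \<rho> x) + C (t - x)\<^sup>2\<close> on the whole half-line, and applying \<open>D\<close>
  in \<open>t\<close> gives the weighted estimate.
\<close>

section \<open>Growth and increments relative to the weight \<open>rho\<close>\<close>

lemma rho_pos: "rho x > 0"
  by (simp add: rho_def add_pos_nonneg)

text \<open>Lets the linear term of the second moment be measured against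
  \<open>rho\<close>.\<close>

lemma abs_le_rho: "\<bar>x\<bar> \<le> rho x"
proof -
  have "0 \<le> (\<bar>x\<bar> - 1)\<^sup>2" by simp
  then have "2 * \<bar>x\<bar> \<le> 1 + x\<^sup>2" by (simp add: power2_diff)
  then show ?thesis by (simp add: rho_def)
qed

text \<open>Far out, the growth terms absorb both values of \<open>g\<close>. Otherwise at least one
  point lies in a compact interval, where \<open>g\<close> is bounded and uniformly continuous:
  close points are handled by continuity, and distant points make \<open>(t - x)\<^sup>2\<close>
  large enough to absorb the bound.\<close>

lemma small_at_infinity_increment_bound:
  fixes g :: "real \<Rightarrow> real"
  assumes cont: "continuous_on {0..} g"
    and lim: "((\<lambda>x. g x / rho x) \<longlongrightarrow> 0) at_top"
    and e: "\<epsilon> > 0"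
  obtains C where "C \<ge> 0"
    "\<And>t x. t \<ge> 0 \<Longrightarrow> x \<ge> 0 \<Longrightarrow> \<bar>g t - g x\<bar> \<le> \<epsilon> * (rho t + rho x) + C * (t - x)\<^sup>2"
proof -
  have "\<forall>\<^sub>F x in at_top. \<bar>g x / rho x\<bar> < \<epsilon>"
    using tendstoD[OF lim e] by (simp add: dist_real_def)
  then obtain A0 where A0: "\<And>x. x \<ge> A0 \<Longrightarrow> \<bar>g x / rho x\<bar> < \<epsilon>"
    by (auto simp: eventually_at_top_linorder)
  define A where "A = max A0 0"
  have A: "A \<ge> 0" by (simp add: A_def)
  have tail: "\<bar>g x\<bar> \<le> \<epsilon> * rho x" if "x \<ge> A" for x
  proof -
    have "\<bar>g x\<bar> / rho x < \<epsilon>" using A0[of x] that rho_pos[of x] by (simp add: A_def abs_divide)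
    then show ?thesis using rho_pos[of x] by (simp add: divide_less_eq)
  qed
  \<comment> \<open>The extra unit ensures that points on either side of the strip between
    \<open>A\<close> and \<open>A + 1\<close> are at distance at least 1.\<close>
  have cont': "continuous_on {0..A + 1} g"
    using cont by (rule continuous_on_subset) auto
  have "bounded (g ` {0..A + 1})"
    using compact_continuous_image[OF cont' compact_Icc] compact_imp_bounded by blast
  then obtain M where M: "\<And>x. x \<in> {0..A + 1} \<Longrightarrow> \<bar>g x\<bar> \<le> M"
    unfolding bounded_iff by fastforce
  have M0: "M \<ge> 0" using M[of 0] A by auto
  have "uniformly_continuous_on {0..A + 1} g"
    using compact_uniformly_continuous[OF cont' compact_Icc] .
  then obtain d where d: "d > 0"
    and uc: "\<And>x t. x \<in> {0..A + 1} \<Longrightarrow> t \<in> {0..A + 1} \<Longrightarrow> dist t x < d \<Longrightarrow> dist (g t) (g x) < \<epsilon>"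
    using e unfolding uniformly_continuous_on_def by blast
  \<comment> \<open>The first summand pays for a pair straddling the strip, the second for a pair in
    the compact interval at distance at least \<open>d\<close>.\<close>
  define C where "C = M + 2 * M / d\<^sup>2"
  have C_ge: "C \<ge> M" "C \<ge> 2 * M / d\<^sup>2" "C \<ge> 0"
    using M0 d by (auto simp: C_def)
  have erho: "\<epsilon> * rho x \<ge> \<epsilon>" for x
    using e by (simp add: rho_def)
  \<comment> \<open>The claim is symmetric in \<open>t\<close> and \<open>x\<close>, so ordered
    pairs suffice.\<close>
  have mixed: "\<bar>g t - g x\<bar> \<le> \<epsilon> * (rho t + rho x) + C * (t - x)\<^sup>2"
    if tx: "t \<ge> 0" "x \<ge> 0" "t \<le> x" for t x
  proof -
    have pos: "\<epsilon> * rho t \<ge> 0" "\<epsilon> * rho x \<ge> 0" "C * (t - x)\<^sup>2 \<ge> 0"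
      using e C_ge rho_pos[of t] rho_pos[of x] by (auto intro: mult_nonneg_nonneg)
    consider "t \<ge> A" | "t < A" "x > A + 1" | "t < A" "x \<le> A + 1" "\<bar>t - x\<bar> < d"
      | "t < A" "x \<le> A + 1" "\<bar>t - x\<bar> \<ge> d"
      by linarith
    then show ?thesis
    proof cases
      case 1
      then show ?thesis
        using tail[of t] tail[of x] tx pos abs_triangle_ineq4[of "g t" "g x"]
        by (simp add: distrib_left)
    next
      case 2
      have "1 \<le> (x - t)\<^sup>2" using 2 by (intro one_le_power) simp
      then have "M \<le> C * (t - x)\<^sup>2"
        using mult_mono[of M C 1 "(t - x)\<^sup>2"] C_ge M0 by (simp add: power2_commute)
      moreover have "\<bar>g t\<bar> \<le> M" using M[of t] 2 tx by simp
      moreover have "\<bar>g x\<bar> \<le> \<epsilon> * rho x" using tail[of x] 2 by simp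
      ultimately show ?thesis
        using pos abs_triangle_ineq4[of "g t" "g x"] by (simp add: distrib_left)
    next
      case 3
      then have "\<bar>g t - g x\<bar> < \<epsilon>"
        using uc[of x t] tx by (simp add: dist_real_def)
      then show ?thesis using erho[of x] pos by (simp add: distrib_left)
    next
      case 4
      have "d\<^sup>2 \<le> (t - x)\<^sup>2" using 4(3) d by (simp add: abs_le_square_iff[symmetric])
      then have "2 * M / d\<^sup>2 * d\<^sup>2 \<le> C * (t - x)\<^sup>2"
        using C_ge by (intro mult_mono) auto
      then have "2 * M \<le> C * (t - x)\<^sup>2" using d by simp
      moreover have "\<bar>g t\<bar> \<le> M" "\<bar>g x\<bar> \<le> M" using M 4 tx by auto
      ultimately show ?thesis
        using pos abs_triangle_ineq4[of "g t" "g x"] by (simp add: distrib_left)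
    qed
  qed
  show thesis
  proof (rule that[OF C_ge(3)])
    fix t x :: real
    assume "t \<ge> 0" "x \<ge> 0"
    then show "\<bar>g t - g x\<bar> \<le> \<epsilon> * (rho t + rho x) + C * (t - x)\<^sup>2"
      using mixed[of t x] mixed[of x t]
      by (cases "t \<le> x") (auto simp: abs_minus_commute power2_commute add.commute)
  qed
qed

text \<open>Subtracting \<open>k * rho\<close> makes the limit at infinity zero, and
  \<open>k * (t\<^sup>2 - x\<^sup>2)\<close> is exactly the increment of
  \<open>k * rho\<close>.\<close>

lemma Q_rho_lim_increment_bound:
  assumes f: "f \<in> Q_rho_lim k" and e: "\<epsilon> > 0"
  obtains C where "C \<ge> 0"
    "\<And>t x. t \<ge> 0 \<Longrightarrow> x \<ge> 0 \<Longrightarrow>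
       \<bar>f t - f x - k * (t\<^sup>2 - x\<^sup>2)\<bar> \<le> \<epsilon> * (rho t + rho x) + C * (t - x)\<^sup>2"
proof -
  define g where "g x = f x - k * rho x" for x
  have "continuous_on {0..} g"
    using f unfolding g_def Q_rho_lim_def Q_rho_def rho_def
    by (auto intro!: continuous_intros)
  moreover have "((\<lambda>x. g x / rho x) \<longlongrightarrow> 0) at_top"
  proof -
    have "((\<lambda>x. f x / rho x - k) \<longlongrightarrow> k - k) at_top"
      using f by (intro tendsto_intros) (simp add: Q_rho_lim_def)
    moreover have "f x / rho x - k = g x / rho x" for x
      using rho_pos[of x] by (simp add: g_def diff_divide_distrib)
    ultimately show ?thesis by simp
  qed
  ultimately obtain C where C: "C \<ge> 0"
    "\<And>t x. t \<ge> 0 \<Longrightarrow> x \<ge> 0 \<Longrightarrow> \<bar>g t - g x\<bar> \<le> \<epsilon> * (rho t + rho x) + C * (t - x)\<^sup>2"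
    using small_at_infinity_increment_bound[OF _ _ e] by blast
  moreover have "g t - g x = f t - f x - k * (t\<^sup>2 - x\<^sup>2)" for t x
    by (simp add: g_def rho_def algebra_simps)
  ultimately show thesis using that by auto
qed

section \<open>Growth of the q-integers\<close>

lemma q_number_eq_sum: "q \<noteq> 1 \<Longrightarrow> q_number q n = (\<Sum>i<n. q ^ i)"
  by (simp add: q_number_def sum_gp_strict)

lemma q_number_pos: "0 < q \<Longrightarrow> q < 1 \<Longrightarrow> n \<ge> 1 \<Longrightarrow> q_number q n > 0"
  by (simp add: q_number_def power_less_one_iff)

text \<open>For fixed \<open>m\<close> and \<open>n \<ge> m\<close>, the geometric sum dominates its
  first \<open>m\<close> terms, whose sum tends to \<open>m\<close> as \<open>q n\<close> tends to
  1.\<close>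

lemma q_number_at_top:
  assumes q: "\<And>n. n \<ge> 1 \<Longrightarrow> 0 < q n \<and> q n < 1" and lim: "q \<longlonglongrightarrow> 1"
  shows "filterlim (\<lambda>n. q_number (q n) n) at_top sequentially"
proof (rule filterlim_at_top_dense[THEN iffD2], intro allI)
  fix Z :: real
  obtain m :: nat where m: "Z < real m" using reals_Archimedean2 by blast
  have "(\<lambda>n. \<Sum>i<m. q n ^ i) \<longlonglongrightarrow> (\<Sum>i<m. 1 ^ i)"
    by (intro tendsto_intros lim)
  then have "\<forall>\<^sub>F n in sequentially. Z < (\<Sum>i<m. q n ^ i)"
    using m by (intro order_tendstoD) auto
  then show "\<forall>\<^sub>F n in sequentially. Z < q_number (q n) n"
    using eventually_ge_at_top[of "max m 1"]
  proof eventually_elim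
    case (elim n)
    have "(\<Sum>i<m. q n ^ i) \<le> (\<Sum>i<n. q n ^ i)"
      using elim q[of n] by (intro sum_mono2) auto
    then show ?case using elim q[of n] by (simp add: q_number_eq_sum)
  qed
qed

section \<open>Weights, nodes and their recursions\<close>

locale dunkl =
  fixes \<mu> q :: real
  assumes mu: "\<mu> \<ge> 0" and q0: "0 < q" and q1: "q < 1"
begin

text \<open>The Dunkl analogue of the q-integer; for positive index it is the ratio of consecutive
  values of \<open>dunkl_gamma\<close>.\<close>

definition bracket :: "nat \<Rightarrow> real" where
  "bracket k = (1 - q powr (2 * \<mu> * parity k + real k)) / (1 - q)"

definition weight :: "real \<Rightarrow> nat \<Rightarrow> real" where
  "weight y k = q ^ (k * (k - 1) div 2) * y ^ k / dunkl_gamma \<mu> q k"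

text \<open>The operator's node without its factor \<open>q / q_number q n\<close>, so that the
  recursions do not involve \<open>n\<close>. The exponent is -1 at \<open>k = 0\<close>, hence the
  integer power.\<close>

definition base_node :: "nat \<Rightarrow> real" where
  "base_node k = bracket k / q powi (int k - 1)"

text \<open>The increment of \<open>bracket\<close> from \<open>k\<close> to \<open>Suc k\<close>,
  divided by \<open>q ^ k\<close>; it would be 1 for ordinary q-integers.\<close>

definition bracket_gap :: "nat \<Rightarrow> real" where
  "bracket_gap k = (q powr (2 * \<mu> * parity k) - q powr (2 * \<mu> * parity (Suc k) + 1)) / (1 - q)"

lemma bracket_0 [simp]: "bracket 0 = 0"
  using q0 by (simp add: bracket_def parity_def)

lemma base_node_0 [simp]: "base_node 0 = 0"
  by (simp add: base_node_def)

lemma bracket_Suc_ge_1: "bracket (Suc k) \<ge> 1"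
proof -
  have "q powr (2 * \<mu> * parity (Suc k) + real (Suc k)) \<le> q powr 1"
    using mu q0 q1 by (intro powr_mono') (auto simp: parity_def)
  then show ?thesis using q0 q1 by (simp add: bracket_def)
qed

lemma bracket_nonneg: "bracket k \<ge> 0"
  using bracket_Suc_ge_1 by (cases k) (auto intro: order_trans[OF zero_le_one])

lemma base_node_nonneg: "base_node k \<ge> 0"
  using bracket_nonneg[of k] q0 by (simp add: base_node_def)

lemma gamma_Suc: "dunkl_gamma \<mu> q (Suc k) = bracket (Suc k) * dunkl_gamma \<mu> q k"
  by (simp add: bracket_def add_ac)

lemma gamma_pos: "dunkl_gamma \<mu> q k > 0"
proof (induction k)
  case (Suc k)
  then show ?case
    unfolding gamma_Suc using bracket_Suc_ge_1[of k] by (intro mult_pos_pos) auto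
qed simp

lemma weight_nonneg: "y \<ge> 0 \<Longrightarrow> weight y k \<ge> 0"
  using gamma_pos[of k] q0 by (simp add: weight_def)

text \<open>The triangular exponent grows by \<open>k\<close> and \<open>dunkl_gamma\<close> by the
  factor \<open>bracket (Suc k)\<close>.\<close>

lemma weight_Suc: "weight y (Suc k) * bracket (Suc k) = y * q ^ k * weight y k"
proof -
  have "Suc k * (Suc k - 1) div 2 = k + k * (k - 1) div 2"
    by (cases k) auto
  then show ?thesis
    using bracket_Suc_ge_1[of k] gamma_pos[of k]
    unfolding weight_def gamma_Suc by (simp add: power_add field_simps)
qed

text \<open>Since \<open>bracket (Suc k)\<close> is at least 1, the ratio of consecutive weights is
  at most \<open>y * q ^ k\<close>, which tends to 0.\<close>

lemma summable_weight:
  assumes y: "y \<ge> 0"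
  shows "summable (weight y)"
proof -
  have "(\<lambda>k. y * q ^ k) \<longlonglongrightarrow> y * 0"
    using q0 q1 by (intro tendsto_mult tendsto_const LIMSEQ_realpow_zero) auto
  then have "\<forall>\<^sub>F k in sequentially. y * q ^ k < 1 / 2"
    by (intro order_tendstoD) auto
  then obtain N where N: "\<And>k. k \<ge> N \<Longrightarrow> y * q ^ k < 1 / 2"
    by (auto simp: eventually_sequentially)
  show ?thesis
  proof (rule summable_ratio_test[of "1 / 2" N])
    fix k assume k: "k \<ge> N"
    have "weight y (Suc k) * 1 \<le> weight y (Suc k) * bracket (Suc k)"
      by (intro mult_left_mono bracket_Suc_ge_1 weight_nonneg y)
    also have "\<dots> = y * q ^ k * weight y k" by (rule weight_Suc)
    also have "\<dots> \<le> 1 / 2 * weight y k"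
      using N[OF k] by (intro mult_right_mono weight_nonneg y) auto
    finally show "norm (weight y (Suc k)) \<le> 1 / 2 * norm (weight y k)"
      using weight_nonneg[OF y] by simp
  qed simp
qed

lemma dunkl_exp_eq_suminf: "dunkl_exp \<mu> q y = suminf (weight y)"
  unfolding dunkl_exp_def weight_def ..

lemma weight_sums: "y \<ge> 0 \<Longrightarrow> weight y sums dunkl_exp \<mu> q y"
  by (simp add: dunkl_exp_eq_suminf summable_weight summable_sums)

lemma dunkl_exp_pos:
  assumes y: "y \<ge> 0"
  shows "dunkl_exp \<mu> q y > 0"
proof -
  have "weight y 0 \<le> suminf (weight y)"
    using sum_le_suminf[OF summable_weight[OF y], of "{0}"] weight_nonneg[OF y] by simp
  then show ?thesis by (simp add: dunkl_exp_eq_suminf weight_def)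
qed

text \<open>The denominator of the node cancels the \<open>q ^ k\<close> of
  \<open>weight_Suc\<close>, so a factor \<open>base_node\<close> under the sum amounts to an index
  shift and a factor \<open>y\<close>.\<close>

lemma weight_base_node_Suc: "weight y (Suc k) * base_node (Suc k) = y * weight y k"
  using weight_Suc[of y k] q0 by (simp add: base_node_def field_simps)

lemma base_node_Suc: "base_node (Suc k) = base_node k / q + bracket_gap k"
proof -
  have "bracket (Suc k) = bracket k + q ^ k * bracket_gap k"
    using q0 q1
    by (simp add: bracket_def bracket_gap_def powr_add powr_realpow field_simps)
  moreover have "q powi (int k - 1) = q ^ k / q"
    using q0 by (simp add: power_int_diff)
  ultimately show ?thesis
    using q0 by (simp add: base_node_def field_simps)
qed

text \<open>Both exponents lie between 0 and \<open>2 * \<mu> + 1\<close>, so by Bernoulli both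
  powers are within \<open>O(1 - q)\<close> of 1; the division by \<open>1 - q\<close> leaves a
  bound uniform in \<open>q\<close> and \<open>k\<close>.\<close>

lemma abs_bracket_gap_le: "\<bar>bracket_gap k\<bar> \<le> 2 * \<mu> + 2"
proof -
  \<comment> \<open>Rounded up because Bernoulli's inequality is applied with a natural
    exponent.\<close>
  define N where "N = nat \<lceil>2 * \<mu> + 1\<rceil>"
  have N: "2 * \<mu> + 1 \<le> real N" "real N \<le> 2 * \<mu> + 2"
    using mu unfolding N_def by linarith+
  have bounds: "q powr s \<le> 1 \<and> 1 - q powr s \<le> real N * (1 - q)" if "0 \<le> s" "s \<le> 2 * \<mu> + 1" for s
  proof -
    have "1 + real N * (q - 1) \<le> (1 + (q - 1)) ^ N"
      using q0 by (intro Bernoulli_inequality) auto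
    also have "\<dots> = q powr real N" using q0 by (simp add: powr_realpow)
    also have "\<dots> \<le> q powr s" using N that q0 q1 by (intro powr_mono') auto
    finally have "1 - q powr s \<le> real N * (1 - q)" by (simp add: algebra_simps)
    moreover have "q powr s \<le> q powr 0" using that q0 q1 by (intro powr_mono') auto
    ultimately show ?thesis using q0 by simp
  qed
  have "\<bar>q powr (2 * \<mu> * parity k) - q powr (2 * \<mu> * parity (Suc k) + 1)\<bar> \<le> real N * (1 - q)"
    using bounds[of "2 * \<mu> * parity k"] bounds[of "2 * \<mu> * parity (Suc k) + 1"] mu
    by (auto simp: parity_def abs_le_iff)
  then have "\<bar>bracket_gap k\<bar> \<le> real N"
    using q1 by (simp add: bracket_gap_def abs_divide divide_le_eq)
  then show ?thesis using N by simp
qed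

section \<open>First and second moments of the weights\<close>

text \<open>An index shift; the term at 0 vanishes because \<open>base_node 0 = 0\<close>.\<close>

lemma first_moment:
  assumes y: "y \<ge> 0"
  shows "(\<lambda>k. weight y k * base_node k) sums (y * dunkl_exp \<mu> q y)"
proof -
  have "(\<lambda>k. weight y (Suc k) * base_node (Suc k)) sums (y * dunkl_exp \<mu> q y)"
    unfolding weight_base_node_Suc by (intro sums_mult weight_sums y)
  then show ?thesis
    using sums_Suc_iff[of "\<lambda>k. weight y k * base_node k"] by simp
qed

text \<open>One factor \<open>base_node\<close> shifts the index, the other is expanded by
  \<open>base_node_Suc\<close>. The number \<open>c\<close> is the weighted mean of
  \<open>bracket_gap\<close>, of which only the size matters.\<close>

lemma second_moment:
  assumes y: "y \<ge> 0"
  obtains c where "\<bar>c\<bar> \<le> 2 * \<mu> + 2"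
    "(\<lambda>k. weight y k * (base_node k)\<^sup>2) sums ((y\<^sup>2 / q + y * c) * dunkl_exp \<mu> q y)"
proof -
  let ?E = "dunkl_exp \<mu> q y"
  have E: "?E > 0" using dunkl_exp_pos[OF y] .
  have gap: "norm (weight y k * bracket_gap k) \<le> (2 * \<mu> + 2) * weight y k" for k
    using mult_right_mono[OF abs_bracket_gap_le weight_nonneg[OF y], of k k]
      weight_nonneg[OF y, of k] by (simp add: abs_mult mult.commute)
  have bound_summable: "summable (\<lambda>k. (2 * \<mu> + 2) * weight y k)"
    by (intro summable_mult summable_weight y)
  have gap_summable: "summable (\<lambda>k. weight y k * bracket_gap k)"
    by (rule summable_comparison_test'[OF bound_summable gap])
  define G where "G = (\<Sum>k. weight y k * bracket_gap k)"
  have "norm G \<le> (\<Sum>k. (2 * \<mu> + 2) * weight y k)"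
    unfolding G_def by (rule norm_suminf_le[OF gap bound_summable])
  also have "\<dots> = (2 * \<mu> + 2) * ?E"
    using sums_unique[OF sums_mult[OF weight_sums[OF y]]] by simp
  finally have G: "\<bar>G\<bar> \<le> (2 * \<mu> + 2) * ?E" by simp
  have "(\<lambda>k. y * (weight y k * base_node k / q + weight y k * bracket_gap k))
      sums (y * (y * ?E / q + G))"
    unfolding G_def
    by (intro sums_mult sums_add sums_divide first_moment y summable_sums gap_summable)
  moreover have "weight y (Suc k) * (base_node (Suc k))\<^sup>2 =
      y * (weight y k * base_node k / q + weight y k * bracket_gap k)" for k
  proof -
    have "weight y (Suc k) * (base_node (Suc k))\<^sup>2 = y * weight y k * base_node (Suc k)"
      unfolding power2_eq_square mult.assoc[symmetric] weight_base_node_Suc ..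
    then show ?thesis by (simp add: base_node_Suc distrib_left)
  qed
  ultimately have "(\<lambda>k. weight y k * (base_node k)\<^sup>2) sums (y * (y * ?E / q + G))"
    using sums_Suc_iff[of "\<lambda>k. weight y k * (base_node k)\<^sup>2"] by simp
  moreover have "y * (y * ?E / q + G) = (y\<^sup>2 / q + y * (G / ?E)) * ?E"
    using E by (simp add: field_simps power2_eq_square)
  moreover have "\<bar>G / ?E\<bar> \<le> 2 * \<mu> + 2"
    using G E by (simp add: abs_divide divide_le_eq)
  ultimately show thesis using that by metis
qed

section \<open>The operator as a weighted mean, and its error\<close>

definition node :: "nat \<Rightarrow> nat \<Rightarrow> real" where
  "node n k = q * base_node k / q_number q n"

lemma node_nonneg: "n \<ge> 1 \<Longrightarrow> node n k \<ge> 0"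
  using base_node_nonneg[of k] q0 q1 q_number_pos[of q n] by (simp add: node_def)

text \<open>At \<open>n = 0\<close> both sides are divisions by zero and equal 0.\<close>

lemma node_eq:
  "(1 - q powr (2 * \<mu> * parity k + real k)) / (q powi (int k - 2) * (1 - q ^ n)) = node n k"
proof -
  have "q powi (int k - 1) = q * q powi (int k - 2)"
    using q0 power_int_add_1'[of q "int k - 2"] by simp
  then show ?thesis
    using q0 q1 by (simp add: node_def base_node_def bracket_def q_number_def)
qed

lemma dunkl_szasz_eq:
  "dunkl_szasz \<mu> n q f x =
     (\<Sum>k. weight (q_number q n * x) k * f (node n k)) / dunkl_exp \<mu> q (q_number q n * x)"
  unfolding dunkl_szasz_def node_eq by (simp add: weight_def mult.commute)

text \<open>Relative to \<open>rho x\<close>, the term \<open>1 - q + (2 \<mu> + 2) / [n]\<^sub>q\<close> dominates the deviations of both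
  the second moment and the second central moment.\<close>

lemma dunkl_szasz_error:
  assumes n: "n \<ge> 1" and x: "x \<ge> 0" and e: "\<epsilon> \<ge> 0" and C: "C \<ge> 0"
    and f: "\<And>t. t \<ge> 0 \<Longrightarrow>
      \<bar>f t - f x - k * (t\<^sup>2 - x\<^sup>2)\<bar> \<le> \<epsilon> * (rho t + rho x) + C * (t - x)\<^sup>2"
  shows "\<bar>dunkl_szasz \<mu> n q f x - f x\<bar> \<le>
    (2 * \<epsilon> + (\<bar>k\<bar> + \<epsilon> + C) * (1 - q + (2 * \<mu> + 2) / q_number q n)) * rho x"
proof -
  define m where "m = q_number q n"
  have m: "m > 0" using q_number_pos[OF q0 q1 n] by (simp add: m_def)
  define y where "y = m * x"
  have y: "y \<ge> 0" using m x by (simp add: y_def)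
  let ?E = "dunkl_exp \<mu> q y"
  have E: "?E > 0" using dunkl_exp_pos[OF y] .
  obtain c where c: "\<bar>c\<bar> \<le> 2 * \<mu> + 2"
    and M2: "(\<lambda>j. weight y j * (base_node j)\<^sup>2) sums ((y\<^sup>2 / q + y * c) * ?E)"
    using second_moment[OF y] .
  \<comment> \<open>The coefficient of \<open>x\<close> in the normalised second moment
    \<open>q * x\<^sup>2 + r * x\<close>.\<close>
  define r where "r = q\<^sup>2 * c / m"
  define \<delta> where "\<delta> = 1 - q + (2 * \<mu> + 2) / m"
  have t0: "weight y sums ?E" using weight_sums[OF y] .
  have "(\<lambda>j. q / m * (weight y j * base_node j)) sums (q / m * (y * ?E))"
    by (intro sums_mult first_moment y)
  then have t1: "(\<lambda>j. weight y j * node n j) sums (q * x * ?E)"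
    using m by (simp add: node_def y_def m_def field_simps)
  have "(\<lambda>j. (q / m)\<^sup>2 * (weight y j * (base_node j)\<^sup>2)) sums ((q / m)\<^sup>2 * ((y\<^sup>2 / q + y * c) * ?E))"
    by (intro sums_mult M2)
  moreover have "(q / m)\<^sup>2 * ((y\<^sup>2 / q + y * c) * ?E) = (q * x\<^sup>2 + r * x) * ?E"
    using m q0 by (simp add: y_def r_def field_simps power2_eq_square)
  ultimately have t2: "(\<lambda>j. weight y j * (node n j)\<^sup>2) sums ((q * x\<^sup>2 + r * x) * ?E)"
    by (simp add: node_def m_def power_mult_distrib power_divide mult_ac)
  \<comment> \<open>\<open>h\<close> is the part of the error left after removing the quadratic
    increment, and \<open>B\<close> its majorant. \<open>B\<close> is quadratic in the node, so the
    three moments sum it exactly.\<close>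
  define h where "h j = weight y j * (f (node n j) - f x - k * ((node n j)\<^sup>2 - x\<^sup>2))" for j
  define B where "B j = weight y j * (\<epsilon> * (rho (node n j) + rho x) + C * (node n j - x)\<^sup>2)" for j
  have hB: "norm (h j) \<le> B j" for j
    using mult_left_mono[OF f[OF node_nonneg[OF n]] weight_nonneg[OF y], of j j]
      weight_nonneg[OF y, of j] by (simp add: h_def B_def abs_mult)
  have B_sums: "B sums ((\<epsilon> * (2 + (q * x\<^sup>2 + r * x) + x\<^sup>2) + C * ((1 - q) * x\<^sup>2 + r * x)) * ?E)"
  proof -
    have "(\<lambda>j. (\<epsilon> * (2 + x\<^sup>2) + C * x\<^sup>2) * weight y j + (\<epsilon> + C) * (weight y j * (node n j)\<^sup>2)
        - 2 * C * x * (weight y j * node n j))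
      sums ((\<epsilon> * (2 + x\<^sup>2) + C * x\<^sup>2) * ?E + (\<epsilon> + C) * ((q * x\<^sup>2 + r * x) * ?E)
        - 2 * C * x * (q * x * ?E))"
      by (intro sums_add sums_diff sums_mult t0 t1 t2)
    moreover have "(\<epsilon> * (2 + x\<^sup>2) + C * x\<^sup>2) * weight y j + (\<epsilon> + C) * (weight y j * (node n j)\<^sup>2)
        - 2 * C * x * (weight y j * node n j) = B j" for j
      by (simp add: B_def rho_def algebra_simps power2_eq_square)
    moreover have "(\<epsilon> * (2 + x\<^sup>2) + C * x\<^sup>2) * ?E + (\<epsilon> + C) * ((q * x\<^sup>2 + r * x) * ?E)
        - 2 * C * x * (q * x * ?E)
      = (\<epsilon> * (2 + (q * x\<^sup>2 + r * x) + x\<^sup>2) + C * ((1 - q) * x\<^sup>2 + r * x)) * ?E"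
      by (simp add: algebra_simps power2_eq_square)
    ultimately show ?thesis by simp
  qed
  have h_summable: "summable h"
    by (rule summable_comparison_test'[OF sums_summable[OF B_sums] hB])
  have "norm (suminf h) \<le> suminf B"
    by (rule norm_suminf_le[OF hB sums_summable[OF B_sums]])
  then have h_le: "\<bar>suminf h\<bar> / ?E \<le>
      \<epsilon> * (2 + (q * x\<^sup>2 + r * x) + x\<^sup>2) + C * ((1 - q) * x\<^sup>2 + r * x)"
    using sums_unique[OF B_sums] E by (simp add: divide_le_eq)
  have "(\<lambda>j. h j + f x * weight y j + k * (weight y j * (node n j)\<^sup>2) - k * x\<^sup>2 * weight y j)
      sums (suminf h + f x * ?E + k * ((q * x\<^sup>2 + r * x) * ?E) - k * x\<^sup>2 * ?E)"
    by (intro sums_add sums_diff sums_mult t0 t2 summable_sums h_summable)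
  moreover have "h j + f x * weight y j + k * (weight y j * (node n j)\<^sup>2) - k * x\<^sup>2 * weight y j
      = weight y j * f (node n j)" for j
    by (simp add: h_def algebra_simps)
  ultimately have "(\<Sum>j. weight y j * f (node n j)) =
      suminf h + f x * ?E + k * ((q * x\<^sup>2 + r * x) * ?E) - k * x\<^sup>2 * ?E"
    by (simp add: sums_iff)
  \<comment> \<open>The last term is \<open>k\<close> times the deviation of the second moment from
    \<open>x\<^sup>2\<close>.\<close>
  then have D: "dunkl_szasz \<mu> n q f x - f x = suminf h / ?E + k * (r * x - (1 - q) * x\<^sup>2)"
    unfolding dunkl_szasz_eq m_def[symmetric] y_def[symmetric]
    using E by (simp add: field_simps)
  have r: "\<bar>r\<bar> \<le> (2 * \<mu> + 2) / m"
  proof -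
    have "\<bar>q\<^sup>2 * c\<bar> \<le> 1 * (2 * \<mu> + 2)"
      unfolding abs_mult using c q0 q1 by (intro mult_mono) (auto simp: power_le_one)
    then show ?thesis using m by (simp add: r_def abs_divide divide_right_mono)
  qed
  have rx: "\<bar>r * x\<bar> \<le> (2 * \<mu> + 2) / m * rho x"
    unfolding abs_mult using r abs_le_rho[of x] by (intro mult_mono) auto
  have qx: "0 \<le> (1 - q) * x\<^sup>2" "(1 - q) * x\<^sup>2 \<le> (1 - q) * rho x"
    using q1 by (auto simp: rho_def)
  \<comment> \<open>The second expression is the normalised central moment of
    \<open>(t - x)\<^sup>2\<close>.\<close>
  have dev: "\<bar>r * x - (1 - q) * x\<^sup>2\<bar> \<le> \<delta> * rho x" "(1 - q) * x\<^sup>2 + r * x \<le> \<delta> * rho x"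
    using rx qx unfolding \<delta>_def distrib_right by linarith+
  \<comment> \<open>The left side is the weighted mean of \<open>rho t + rho x\<close>; it differs
    from \<open>2 * rho x\<close> by the first deviation.\<close>
  have growth: "2 + (q * x\<^sup>2 + r * x) + x\<^sup>2 \<le> (2 + \<delta>) * rho x"
    using dev(1) by (simp add: rho_def algebra_simps abs_le_iff)
  have "\<bar>dunkl_szasz \<mu> n q f x - f x\<bar> \<le> \<bar>suminf h\<bar> / ?E + \<bar>k\<bar> * \<bar>r * x - (1 - q) * x\<^sup>2\<bar>"
    unfolding D using E abs_triangle_ineq[of "suminf h / ?E" "k * (r * x - (1 - q) * x\<^sup>2)"]
    by (simp add: abs_mult abs_divide)
  also have "\<dots> \<le> (\<epsilon> * ((2 + \<delta>) * rho x) + C * (\<delta> * rho x)) + \<bar>k\<bar> * (\<delta> * rho x)"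
    using h_le mult_left_mono[OF growth e] mult_left_mono[OF dev(2) C]
      mult_left_mono[OF dev(1), of "\<bar>k\<bar>"] by linarith
  also have "\<dots> = (2 * \<epsilon> + (\<bar>k\<bar> + \<epsilon> + C) * \<delta>) * rho x"
    by (simp add: algebra_simps)
  finally show ?thesis by (simp add: \<delta>_def m_def)
qed

end

section \<open>The weighted norm and the passage to the limit\<close>

lemma rho_norm_nonneg: "rho_norm f \<ge> 0"
proof -
  have "ereal (\<bar>f 0\<bar> / rho 0) \<le> rho_norm f"
    unfolding rho_norm_def by (rule SUP_upper) simp
  then show ?thesis
    by (rule order_trans[rotated]) (simp add: rho_def)
qed

lemma rho_norm_le:
  assumes "\<And>x. x \<ge> 0 \<Longrightarrow> \<bar>f x\<bar> \<le> B * rho x"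
  shows "rho_norm f \<le> ereal B"
  unfolding rho_norm_def using assms rho_pos by (intro SUP_least) (simp add: divide_le_eq)

theorem theorem2p4:
  fixes \<mu> a k :: real and q :: "nat \<Rightarrow> real" and f :: "real \<Rightarrow> real"
  assumes "\<mu> > 1 / 2"
    and "\<And>n. n \<ge> 1 \<Longrightarrow> 0 < q n \<and> q n < 1"
    and "q \<longlonglongrightarrow> 1"
    and "(\<lambda>n. q n ^ n) \<longlonglongrightarrow> a"
    and "f \<in> Q_rho_lim k"
  shows "(\<lambda>n. rho_norm (\<lambda>x. dunkl_szasz \<mu> n (q n) f x - f x)) \<longlonglongrightarrow> 0"
proof (rule order_tendstoI)
  fix b :: ereal
  assume "b < 0"
  then show "\<forall>\<^sub>F n in sequentially. b < rho_norm (\<lambda>x. dunkl_szasz \<mu> n (q n) f x - f x)"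
    using rho_norm_nonneg by (auto intro: always_eventually less_le_trans)
next
  fix b :: ereal
  assume "0 < b"
  \<comment> \<open>The bound \<open>b\<close> may be infinite, so a real number below it takes its
    place.\<close>
  then obtain e where e: "0 < ereal e" "ereal e < b"
    using ereal_dense2 by blast
  have e4: "e / 4 > 0" using e by simp
  obtain C where C: "C \<ge> 0"
    "\<And>t x. t \<ge> 0 \<Longrightarrow> x \<ge> 0 \<Longrightarrow>
       \<bar>f t - f x - k * (t\<^sup>2 - x\<^sup>2)\<bar> \<le> e / 4 * (rho t + rho x) + C * (t - x)\<^sup>2"
    using Q_rho_lim_increment_bound[OF assms(5) e4] by blast
  define B where "B n = 2 * (e / 4) +
    (\<bar>k\<bar> + e / 4 + C) * (1 - q n + (2 * \<mu> + 2) / q_number (q n) n)" for n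
  have "(\<lambda>n. (2 * \<mu> + 2) / q_number (q n) n) \<longlonglongrightarrow> 0"
    by (intro real_tendsto_divide_at_top[OF tendsto_const] q_number_at_top assms)
  \<comment> \<open>The limit is \<open>e / 2\<close>, so \<open>B n\<close> is eventually below
    \<open>e\<close>; \<open>C\<close> depends on \<open>e\<close> but not on
    \<open>n\<close>.\<close>
  then have "B \<longlonglongrightarrow> 2 * (e / 4) + (\<bar>k\<bar> + e / 4 + C) * (1 - 1 + 0)"
    unfolding B_def by (intro tendsto_intros assms)
  then have "\<forall>\<^sub>F n in sequentially. B n < e"
    by (rule order_tendstoD(2)) (use e in simp)
  then show "\<forall>\<^sub>F n in sequentially. rho_norm (\<lambda>x. dunkl_szasz \<mu> n (q n) f x - f x) < b"
    using eventually_ge_at_top[of 1]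
  proof eventually_elim
    case (elim n)
    interpret dunkl \<mu> "q n"
      using assms(1) assms(2)[OF elim(2)] by unfold_locales auto
    have "rho_norm (\<lambda>x. dunkl_szasz \<mu> n (q n) f x - f x) \<le> ereal (B n)"
      unfolding B_def using e4 C elim by (intro rho_norm_le dunkl_szasz_error) auto
    also have "\<dots> < ereal e" using elim(1) by simp
    also note e(2)
    finally show ?case .
  qed
qed

end
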